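(* Let $n,d\ge1$ and let $v_1,\dots,v_n\in\mathbb{S}^{d-1}$ be unit vectors in $\mathbb{R}^d$, no two of which are parallel, and suppose that $\Phi=\{\pm v_1,\dots,\pm v_n\}$ is a finite reflection system. Then $v_1,\dots,v_n$ is an extremal configuration for the strong polarization inequality, i.e. $$\inf\left\{\sum_{j=1}^n\frac{1}{\langle v_j,u\rangle^2}\;:\;u\in\mathbb{S}^{d-1},\ \langle v_j,u\rangle\neq0\text{ for all }j\right\}=n^2.$$
   Context: $\langle\cdot,\cdot\rangle$ is the standard inner product on $\mathbb{R}^d$ and $\mathbb{S}^{d-1}$ is the unit sphere. For a nonzero vector $v\in\mathbb{R}^d$, $s_v$ denotes the orthogonal reflection across the hyperplane $v^\perp$. A finite reflection system of unit vectors in $\mathbb{R}^d$ is a finite subset $\Phi\subset\mathbb{S}^{d-1}$ such that $s_v(\Phi)=\Phi$ for every $v\in\Phi$. The strong polarization inequality asserts that for any unit vectors $v_1,\dots,v_n$ some unit vector $u$ satisfies $\sum_j\langle v_j,u\rangle^{-2}\le n^2$; a configuration is extremal when the bound $n^2$ is attained as the best possible one for it. Two unit vectors $v,w$ are parallel if $v=\pm w$. *)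

theory Defs
  imports "HOL-Analysis.Analysis"
begin

definition hyperplane_reflection :: "real ^ 'd \<Rightarrow> real ^ 'd \<Rightarrow> real ^ 'd" where
  "hyperplane_reflection v x = x - (2 * (v \<bullet> x) / (v \<bullet> v)) *\<^sub>R v"

definition finite_reflection_system :: "(real ^ 'd) set \<Rightarrow> bool" where
  "finite_reflection_system \<Phi> \<longleftrightarrow>
     finite \<Phi> \<and> \<Phi> \<subseteq> sphere 0 1 \<and> (\<forall>v\<in>\<Phi>. hyperplane_reflection v ` \<Phi> = \<Phi>)"

text \<open>Used for unit vectors only.\<close>

definition parallel :: "real ^ 'd \<Rightarrow> real ^ 'd \<Rightarrow> bool" where
  "parallel v w \<longleftrightarrow> v = w \<or> v = - w"

text \<open>The reflection fixes the hyperplane orthogonal to \<open>v\<close> pointwise and negates \<open>v\<close>,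
  which determines it as a linear map.\<close>

lemma hyperplane_reflection_orthogonal: "v \<bullet> x = 0 \<Longrightarrow> hyperplane_reflection v x = x"
  by (simp add: hyperplane_reflection_def)

lemma hyperplane_reflection_self: "hyperplane_reflection v v = - v"
  by (cases "v = 0") (simp_all add: hyperplane_reflection_def scaleR_2)

lemma linear_hyperplane_reflection: "linear (hyperplane_reflection v)"
  by (rule linearI)
    (simp_all add: hyperplane_reflection_def inner_add_right algebra_simps add_divide_distrib)

text \<open>The infimum of a set of reals is only meaningful for nonempty sets bounded below.
  The set of admissible values is bounded below by \<open>0\<close>, and it is nonempty because
  finitely many hyperplanes do not cover the sphere.\<close>

lemma admissible_direction_exists:
  fixes v :: "nat \<Rightarrow> real ^ 'd"
  assumes "\<And>j. j \<in> {1..n} \<Longrightarrow> v j \<in> sphere 0 1"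
  shows "\<exists>u\<in>sphere 0 1. \<forall>j\<in>{1..n}. v j \<bullet> u \<noteq> 0"
proof -
  have "negligible (insert 0 (\<Union>j\<in>{1..n}. {x. v j \<bullet> x = 0}))"
    unfolding negligible_insert
  proof (rule negligible_Union)
    fix T assume "T \<in> (\<lambda>j. {x. v j \<bullet> x = 0}) ` {1..n}"
    then obtain j where "j \<in> {1..n}" "T = {x. v j \<bullet> x = 0}" by blast
    moreover from this assms[of j] have "v j \<noteq> 0" by auto
    ultimately show "negligible T" by (simp add: negligible_hyperplane)
  qed simp
  then obtain x where x: "x \<notin> insert 0 (\<Union>j\<in>{1..n}. {x. v j \<bullet> x = 0})"
    by (metis UNIV_eq_I non_negligible_UNIV)
  show ?thesis
    by (rule bexI[of _ "x /\<^sub>R norm x"]) (use x in auto)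
qed

end

theory Submission
  imports Defs
begin

text \<open>
  For an admissible direction \<open>u\<close> put \<open>g = (\<Sum>j. v j /\<^sub>R (v j \<bullet> u))\<close>, the logarithmic gradient at \<open>u\<close>
  of the polynomial \<open>P x = (\<Prod>j. v j \<bullet> x)\<close>.  Always \<open>g \<bullet> u = n\<close>.  For a reflection system the
  polynomial \<open>P\<close> is alternating under the reflections, and so is \<open>\<Delta>P\<close>; an alternating polynomial
  vanishes on every hyperplane of the system and is thus divisible by \<open>P\<close>, so \<open>\<Delta>P = 0\<close> by degree.
  Now \<open>\<Delta>P / P = (norm g)\<^sup>2 - (\<Sum>j. 1 / (v j \<bullet> u)\<^sup>2)\<close> at \<open>u\<close>, so harmonicity means that the sum to be minimised equals \<open>(norm g)\<^sup>2\<close> (lemma \<open>norm_log_gradient_reflection_system\<close>).  By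
  Cauchy--Schwarz, \<open>(norm g)\<^sup>2 \<ge> (g \<bullet> u)\<^sup>2 = n\<^sup>2\<close>, with equality iff \<open>g = n u\<close>, that is, iff \<open>u\<close> is a
  critical point of \<open>\<bar>P\<bar>\<close> on the sphere; a point where \<open>\<bar>P\<bar>\<close> is maximal on the sphere is one
  (lemma \<open>log_gradient_at_maximum\<close>).

  Harmonicity is obtained without divisibility of polynomials.  Along a generic line through \<open>u\<close>,
  the off-diagonal part of \<open>(norm g)\<^sup>2\<close> is a rational function with at most simple poles, one
  on each hyperplane, and it vanishes at infinity.  Its residue on the hyperplane of \<open>v i\<close> is a multiple of
  the sum of \<open>(v i \<bullet> v j) / (v j \<bullet> x)\<close> over \<open>j \<noteq> i\<close>, where \<open>v i \<bullet> x = 0\<close>, and the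
  reflection in \<open>v i\<close> changes the sign of this sum while permuting its terms (lemma \<open>residue_sum_eq_0\<close>).  A sum of partial fractions
  without residues is zero.
\<close>

section \<open>Reflections and residues\<close>

lemma finite_hyperplanes_avoidable:
  fixes A :: "'a::euclidean_space set"
  assumes "finite A" "0 \<notin> A"
  shows "\<exists>w. \<forall>a\<in>A. a \<bullet> w \<noteq> 0"
proof -
  have "negligible (\<Union>a\<in>A. {x. a \<bullet> x = 0})"
    using assms by (intro negligible_Union) (auto intro!: negligible_hyperplane)
  then have "(\<Union>a\<in>A. {x. a \<bullet> x = 0}) \<noteq> UNIV"
    by (metis non_negligible_UNIV)
  then show ?thesis by blast
qed

lemma inner_hyperplane_reflection_self:
  "k \<bullet> hyperplane_reflection k y = - (k \<bullet> y)"
  by (cases "k = 0") (simp_all add: hyperplane_reflection_def inner_diff_right)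

lemma inner_hyperplane_reflection_orthogonal:
  "k \<bullet> x = 0 \<Longrightarrow> hyperplane_reflection k y \<bullet> x = y \<bullet> x"
  by (simp add: hyperplane_reflection_def inner_diff_left)

text \<open>The reflection in \<open>k\<close> permutes the terms and reverses their signs, since it fixes \<open>x\<close>.
  The terms of \<open>\<plusminus>k\<close> have denominator \<open>0\<close> and count as \<open>0\<close>, so this is the residue sum over the
  other elements of \<open>\<Phi>\<close>.\<close>

lemma residue_sum_eq_0:
  assumes "finite \<Phi>" "hyperplane_reflection k ` \<Phi> = \<Phi>" "k \<bullet> x = 0"
  shows "(\<Sum>y\<in>\<Phi>. (k \<bullet> y) / (y \<bullet> x)) = 0"
proof -
  let ?s = "hyperplane_reflection k"
  have "inj_on ?s \<Phi>"
    using assms by (simp add: eq_card_imp_inj_on)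
  then have "(\<Sum>y\<in>?s ` \<Phi>. (k \<bullet> y) / (y \<bullet> x)) = (\<Sum>y\<in>\<Phi>. (k \<bullet> ?s y) / (?s y \<bullet> x))"
    by (simp add: sum.reindex)
  also have "\<dots> = - (\<Sum>y\<in>\<Phi>. (k \<bullet> y) / (y \<bullet> x))"
    using assms(3)
    by (simp add: inner_hyperplane_reflection_self inner_hyperplane_reflection_orthogonal sum_negf)
  finally show ?thesis
    using assms(2) by simp
qed

lemma sum_even_function_symmetrized:
  fixes v :: "'i \<Rightarrow> 'a::real_vector" and g :: "'a \<Rightarrow> real"
  assumes fin: "finite J"
    and nz: "\<And>j. j \<in> J \<Longrightarrow> v j \<noteq> 0"
    and np: "\<And>i j. i \<in> J \<Longrightarrow> j \<in> J \<Longrightarrow> i \<noteq> j \<Longrightarrow> v i \<noteq> v j \<and> v i \<noteq> - v j"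
    and even: "\<And>y. g (- y) = g y"
  shows "(\<Sum>y\<in>v ` J \<union> (\<lambda>j. - v j) ` J. g y) = 2 * (\<Sum>j\<in>J. g (v j))"
proof -
  have "v i \<noteq> - v j" if "i \<in> J" "j \<in> J" for i j
    using np[OF that] nz[OF that(1)] 
    by (metis scaleR_2 scaleR_eq_0_iff add.right_inverse zero_neq_numeral)
  then have "v ` J \<inter> (\<lambda>j. - v j) ` J = {}"
    by blast
  moreover have "inj_on v J" "inj_on (\<lambda>j. - v j) J"
    using np by (auto simp: inj_on_def)
  ultimately show ?thesis
    using fin by (simp add: sum.union_disjoint sum.reindex even)
qed

section \<open>Harmonicity of the product of linear forms\<close>

definition log_gradient :: "('i \<Rightarrow> 'a::real_inner) \<Rightarrow> 'i set \<Rightarrow> 'a \<Rightarrow> 'a" where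
  "log_gradient v J u = (\<Sum>j\<in>J. v j /\<^sub>R (v j \<bullet> u))"

lemma inner_log_gradient:
  "log_gradient v J u \<bullet> y = (\<Sum>j\<in>J. (v j \<bullet> y) / (v j \<bullet> u))"
  by (simp add: log_gradient_def inner_sum_left divide_inverse mult.commute)

lemma inner_log_gradient_self:
  assumes "\<And>j. j \<in> J \<Longrightarrow> v j \<bullet> u \<noteq> 0"
  shows "log_gradient v J u \<bullet> u = real (card J)"
  using assms by (simp add: inner_log_gradient)

lemma norm_log_gradient_square:
  "(norm (log_gradient v J u))\<^sup>2 = (\<Sum>i\<in>J. \<Sum>j\<in>J. (v i \<bullet> v j) / ((v i \<bullet> u) * (v j \<bullet> u)))"
  unfolding power2_norm_eq_inner log_gradient_def
  by (simp add: inner_sum_left inner_sum_right sum_distrib_left divide_inverse inner_commute mult_ac)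

text \<open>Harmonicity of the product of the linear forms, in the shape of a vanishing off-diagonal sum.
  In the proof, \<open>x i\<close> is the point where the line through \<open>u\<close> in direction \<open>w\<close> meets the hyperplane of
  \<open>v i\<close>, and row \<open>i\<close> of \<open>T\<close> sums to a multiple of the residue sum at \<open>x i\<close>.\<close>

lemma norm_log_gradient_reflection_system:
  fixes v :: "'i \<Rightarrow> real ^ 'd"
  assumes fin: "finite J"
    and unit: "\<And>j. j \<in> J \<Longrightarrow> norm (v j) = 1"
    and np: "\<And>i j. i \<in> J \<Longrightarrow> j \<in> J \<Longrightarrow> i \<noteq> j \<Longrightarrow> \<not> parallel (v i) (v j)"
    and system: "finite_reflection_system (v ` J \<union> (\<lambda>j. - v j) ` J)"
    and adm: "\<And>j. j \<in> J \<Longrightarrow> v j \<bullet> u \<noteq> 0"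
  shows "(norm (log_gradient v J u))\<^sup>2 = (\<Sum>j\<in>J. 1 / (v j \<bullet> u)\<^sup>2)"
proof -
  define a where "a j = v j \<bullet> u" for j
  \<comment> \<open>A direction off these hyperplanes makes the line through \<open>u\<close> meet the hyperplanes of the
    \<open>v j\<close> in pairwise distinct parameters, so all poles along the line are simple.\<close>
  define A where "A = v ` J \<union> (\<lambda>(i, j). a j *\<^sub>R v i - a i *\<^sub>R v j) ` {(i, j) \<in> J \<times> J. i \<noteq> j}"
  have "finite {(i, j) \<in> J \<times> J. i \<noteq> j}"
    by (rule finite_subset[of _ "J \<times> J"]) (use fin in auto)
  then have finA: "finite A"
    unfolding A_def using fin by blast
  have indep: "a j *\<^sub>R v i \<noteq> a i *\<^sub>R v j" if ij: "i \<in> J" "j \<in> J" "i \<noteq> j" for i j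
  proof
    assume eq: "a j *\<^sub>R v i = a i *\<^sub>R v j"
    then have "\<bar>a j\<bar> = \<bar>a i\<bar>"
      using unit ij by (metis mult.right_neutral norm_scaleR)
    then have "a i = a j \<or> a i = - a j" by linarith
    moreover have "a j \<noteq> 0" using adm ij by (simp add: a_def)
    ultimately have "v i = v j \<or> v i = - v j"
      using eq by (metis scaleR_cancel_left scaleR_minus_left scaleR_minus_right)
    then show False using np[OF ij] by (simp add: parallel_def)
  qed
  have nzA: "0 \<notin> A"
    using unit indep unfolding A_def by force
  obtain w where w: "\<And>y. y \<in> A \<Longrightarrow> y \<bullet> w \<noteq> 0"
    using finite_hyperplanes_avoidable[OF finA nzA] by blast
  define b where "b j = v j \<bullet> w" for j
  have b: "b j \<noteq> 0" if "j \<in> J" for j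
    using w[of "v j"] that by (simp add: A_def b_def)
  have ab: "a j * b i - a i * b j \<noteq> 0" if "i \<in> J" "j \<in> J" "i \<noteq> j" for i j
  proof -
    have "a j *\<^sub>R v i - a i *\<^sub>R v j \<in> A"
      unfolding A_def by (rule UnI2, rule image_eqI[of _ _ "(i, j)"]) (simp_all add: that)
    from w[OF this] show ?thesis by (simp add: b_def inner_diff_left)
  qed
  define x where "x i = u - (a i / b i) *\<^sub>R w" for i
  have vx: "v j \<bullet> x i = (a j * b i - a i * b j) / b i" if "i \<in> J" for i j
    using b[OF that] by (simp add: x_def inner_diff_right field_simps a_def b_def)
  define T where "T i j = (v i \<bullet> v j) / (v j \<bullet> x i) / a i" for i j
  have T0: "(\<Sum>j\<in>J. T i j) = 0" if i: "i \<in> J" for i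
  proof -
    let ?g = "\<lambda>y. (v i \<bullet> y) / (y \<bullet> x i)"
    have "v i \<bullet> x i = 0" using vx[OF i] by simp
    then have "0 = (\<Sum>y\<in>v ` J \<union> (\<lambda>j. - v j) ` J. ?g y)"
      using system i by (intro residue_sum_eq_0[symmetric]) (auto simp: finite_reflection_system_def)
    also have "\<dots> = 2 * (\<Sum>j\<in>J. ?g (v j))"
    proof (rule sum_even_function_symmetrized[OF fin])
      show "v j \<noteq> 0" if "j \<in> J" for j using unit[OF that] by auto
      show "v i \<noteq> v j \<and> v i \<noteq> - v j" if "i \<in> J" "j \<in> J" "i \<noteq> j" for i j
        using np[OF that] by (simp add: parallel_def)
    qed simp
    finally show ?thesis
      by (simp add: T_def del: divide_divide_eq_left flip: sum_divide_distrib)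
  qed
  \<comment> \<open>Partial fractions.  On the diagonal \<open>T i i = 0\<close>, its denominator being \<open>0\<close>.\<close>
  have split: "(v i \<bullet> v j) / (a i * a j) = (T i j + T j i) + (if j = i then 1 / (a i)\<^sup>2 else 0)"
    if ij: "i \<in> J" "j \<in> J" for i j
  proof (cases "i = j")
    case True
    then show ?thesis
      using vx[OF ij(1), of i] unit[OF ij(1)]
      by (simp add: T_def power2_eq_square norm_eq_1)
  next
    case False
    have nz: "a i \<noteq> 0" "a j \<noteq> 0" "b i \<noteq> 0" "b j \<noteq> 0"
      using adm b ij by (auto simp: a_def)
    define D where "D = a j * b i - a i * b j"
    have D: "D \<noteq> 0" "a i * b j - a j * b i = - D"
      using ab[OF ij False] by (simp_all add: D_def)
    have "T i j + T j i = (v i \<bullet> v j) * (b i / (a i * D) - b j / (a j * D))"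
      unfolding T_def vx[OF ij(1)] vx[OF ij(2)] D(2) D_def[symmetric]
      using nz D(1) by (simp add: field_simps inner_commute)
    also have "b i / (a i * D) - b j / (a j * D) = D / (a i * a j * D)"
      using nz D(1) by (simp add: divide_simps) (simp add: D_def algebra_simps)
    also have "\<dots> = 1 / (a i * a j)"
      using D(1) by simp
    finally show ?thesis using False by simp
  qed
  have "(norm (log_gradient v J u))\<^sup>2 = (\<Sum>i\<in>J. \<Sum>j\<in>J. (v i \<bullet> v j) / (a i * a j))"
    by (simp add: norm_log_gradient_square a_def)
  also have "\<dots> = (\<Sum>i\<in>J. \<Sum>j\<in>J. (T i j + T j i) + (if j = i then 1 / (a i)\<^sup>2 else 0))"
    using split by (intro sum.cong refl) auto
  also have "\<dots> = (\<Sum>i\<in>J. \<Sum>j\<in>J. T i j) + (\<Sum>i\<in>J. \<Sum>j\<in>J. T j i) + (\<Sum>i\<in>J. 1 / (a i)\<^sup>2)"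
    using fin by (simp add: sum.distrib)
  also have "(\<Sum>i\<in>J. \<Sum>j\<in>J. T j i) = (\<Sum>i\<in>J. \<Sum>j\<in>J. T i j)"
    by (rule sum.swap)
  finally show ?thesis
    using T0 by (simp add: a_def)
qed

section \<open>Maximal points of the product and the extremal value\<close>

text \<open>The hypothesis \<open>max\<close> is the homogeneous form of maximality of the product on the unit sphere.
  With \<open>y = g - n u\<close>, orthogonal to \<open>u\<close>, the logarithmic derivative of the product at \<open>u\<close> in
  direction \<open>y\<close> is \<open>g \<bullet> y = (norm y)\<^sup>2\<close>, while the norm is stationary to first order;
  so \<open>y\<close> must vanish at a maximum.\<close>

lemma log_gradient_at_maximum:
  fixes v :: "'i \<Rightarrow> 'a::real_inner"
  assumes unit: "norm u = 1"
    and adm: "\<And>j. j \<in> J \<Longrightarrow> v j \<bullet> u \<noteq> 0"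
    and max: "\<And>x. (\<Prod>j\<in>J. v j \<bullet> x)\<^sup>2 \<le> (\<Prod>j\<in>J. v j \<bullet> u)\<^sup>2 * (x \<bullet> x) ^ card J"
  shows "log_gradient v J u = real (card J) *\<^sub>R u"
proof -
  define y where "y = log_gradient v J u - real (card J) *\<^sub>R u"
  define c where "c j = (v j \<bullet> y) / (v j \<bullet> u)" for j
  define q where "q = y \<bullet> y"
  have uu: "u \<bullet> u = 1" using unit by (simp add: norm_eq_1)
  have uy: "u \<bullet> y = 0"
    using inner_log_gradient_self[of J v u] adm uu
    by (simp add: y_def inner_diff_right inner_commute)
  have "(\<Sum>j\<in>J. c j) = log_gradient v J u \<bullet> y"
    by (simp add: inner_log_gradient c_def)
  also have "\<dots> = q"
  proof -
    have "log_gradient v J u = y + real (card J) *\<^sub>R u" by (simp add: y_def)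
    then show ?thesis using uy by (simp add: q_def inner_add_left)
  qed
  finally have sumc: "(\<Sum>j\<in>J. c j) = q" .
  define F where "F t = (\<Prod>j\<in>J. 1 + t * c j)\<^sup>2 - (1 + t\<^sup>2 * q) ^ card J" for t
  have F: "F t \<le> 0" for t
  proof -
    have "v j \<bullet> (u + t *\<^sub>R y) = (v j \<bullet> u) * (1 + t * c j)" if "j \<in> J" for j
      using adm[OF that] by (simp add: c_def inner_add_right field_simps)
    then have "(\<Prod>j\<in>J. v j \<bullet> (u + t *\<^sub>R y)) = (\<Prod>j\<in>J. v j \<bullet> u) * (\<Prod>j\<in>J. 1 + t * c j)"
      by (simp add: prod.distrib)
    moreover have "(u + t *\<^sub>R y) \<bullet> (u + t *\<^sub>R y) = 1 + t\<^sup>2 * q"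
      using uu uy by (simp add: inner_add_left inner_add_right inner_commute q_def power2_eq_square)
    ultimately have "(\<Prod>j\<in>J. v j \<bullet> u)\<^sup>2 * (\<Prod>j\<in>J. 1 + t * c j)\<^sup>2
        \<le> (\<Prod>j\<in>J. v j \<bullet> u)\<^sup>2 * (1 + t\<^sup>2 * q) ^ card J"
      using max[of "u + t *\<^sub>R y"] by (simp add: power_mult_distrib)
    moreover have "(\<Prod>j\<in>J. v j \<bullet> u)\<^sup>2 > 0"
      using adm by (cases "finite J") auto
    ultimately show ?thesis
      by (simp add: F_def)
  qed
  have prod': "((\<lambda>t. \<Prod>j\<in>J. 1 + t * c j) has_real_derivative (\<Sum>j\<in>J. c j)) (at 0)"
  proof -
    have "((\<lambda>t. \<Prod>j\<in>J. 1 + t * c j) has_real_derivative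
        (\<Sum>j\<in>J. c j * (\<Prod>i\<in>J - {j}. 1 + 0 * c i))) (at 0)"
      by (rule has_field_derivative_prod) (auto intro!: derivative_eq_intros)
    then show ?thesis by simp
  qed
  have "(F has_real_derivative 2 * q) (at 0)"
    unfolding F_def
    by (auto intro!: derivative_eq_intros prod' simp: sumc)
  moreover have "F t \<le> F 0" for t
    using F by (simp add: F_def)
  ultimately have "2 * q = 0"
    by (intro DERIV_local_max[of F "2 * q" 0 1]) auto
  then show ?thesis by (simp add: q_def y_def)
qed

lemma prod_inner_maximum_on_sphere:
  fixes v :: "'i \<Rightarrow> 'a::euclidean_space"
  shows "\<exists>u. norm u = 1 \<and> (\<forall>x. (\<Prod>j\<in>J. v j \<bullet> x)\<^sup>2 \<le> (\<Prod>j\<in>J. v j \<bullet> u)\<^sup>2 * (x \<bullet> x) ^ card J)"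
proof -
  let ?P = "\<lambda>x. (\<Prod>j\<in>J. v j \<bullet> x)\<^sup>2"
  have "\<exists>u\<in>sphere 0 1. \<forall>x\<in>sphere 0 1. ?P x \<le> ?P u"
    by (rule continuous_attains_sup) (auto intro!: continuous_intros)
  then obtain u where u: "norm u = 1" and max: "\<And>x. norm x = 1 \<Longrightarrow> ?P x \<le> ?P u"
    by auto
  have "?P x \<le> ?P u * (x \<bullet> x) ^ card J" for x
  proof (cases "x = 0")
    case True
    then show ?thesis
      using max[OF u] by (cases "card J = 0") (auto simp: power_0_left card_eq_0_iff)
  next
    case False
    have "(\<Prod>j\<in>J. v j \<bullet> x) = (\<Prod>j\<in>J. norm x * (v j \<bullet> (x /\<^sub>R norm x)))"
      using False by (intro prod.cong) auto
    also have "\<dots> = norm x ^ card J * (\<Prod>j\<in>J. v j \<bullet> (x /\<^sub>R norm x))"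
      by (simp add: prod.distrib del: inner_scaleR_right)
    finally have "?P x = ?P (x /\<^sub>R norm x) * (x \<bullet> x) ^ card J"
      by (simp add: power_mult_distrib mult.commute flip: power2_norm_eq_inner power_mult
          del: inner_scaleR_right)
    also have "\<dots> \<le> ?P u * (x \<bullet> x) ^ card J"
      using max[of "x /\<^sub>R norm x"] False by (intro mult_right_mono) auto
    finally show ?thesis .
  qed
  with u show ?thesis by blast
qed

theorem proposition1:
  fixes v :: "nat \<Rightarrow> real ^ 'd" and n :: nat
  assumes "n \<ge> 1"
    and "\<forall>j\<in>{1..n}. v j \<in> sphere 0 1"
    and "\<forall>i\<in>{1..n}. \<forall>j\<in>{1..n}. i \<noteq> j \<longrightarrow> \<not> parallel (v i) (v j)"
    and "finite_reflection_system (v ` {1..n} \<union> (\<lambda>j. - v j) ` {1..n})"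
  shows "Inf {(\<Sum>j=1..n. 1 / (v j \<bullet> u)\<^sup>2) | u.
               u \<in> sphere 0 1 \<and> (\<forall>j\<in>{1..n}. v j \<bullet> u \<noteq> 0)} = (real n)\<^sup>2"
proof -
  let ?J = "{1..n}"
  have unit: "norm (v j) = 1" if "j \<in> ?J" for j
    using assms(2) that by simp
  have norm_eq: "(\<Sum>j=1..n. 1 / (v j \<bullet> u)\<^sup>2) = (norm (log_gradient v ?J u))\<^sup>2"
    if "\<forall>j\<in>?J. v j \<bullet> u \<noteq> 0" for u
    using assms(3,4) unit that by (intro norm_log_gradient_reflection_system[symmetric]) auto
  have lower: "(real n)\<^sup>2 \<le> (\<Sum>j=1..n. 1 / (v j \<bullet> u)\<^sup>2)"
    if u: "u \<in> sphere 0 1" and adm: "\<forall>j\<in>?J. v j \<bullet> u \<noteq> 0" for u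
  proof -
    have "real n = log_gradient v ?J u \<bullet> u"
      using inner_log_gradient_self[of ?J v u] adm by simp
    also have "\<dots> \<le> norm (log_gradient v ?J u)"
      using norm_cauchy_schwarz[of "log_gradient v ?J u" u] u by simp
    finally show ?thesis
      unfolding norm_eq[OF adm] by (simp add: power_mono)
  qed
  obtain u where u: "norm u = 1"
    and max: "\<And>x. (\<Prod>j\<in>?J. v j \<bullet> x)\<^sup>2 \<le> (\<Prod>j\<in>?J. v j \<bullet> u)\<^sup>2 * (x \<bullet> x) ^ card ?J"
    using prod_inner_maximum_on_sphere[of v ?J] by blast
  \<comment> \<open>The product is nonzero at an admissible direction, hence also at its maximum.\<close>
  obtain x where "\<forall>j\<in>?J. v j \<bullet> x \<noteq> 0"
    using admissible_direction_exists[of n v] assms(2) by blast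
  then have "0 < (\<Prod>j\<in>?J. v j \<bullet> x)\<^sup>2"
    by auto
  also note max[of x]
  finally have "(\<Prod>j\<in>?J. v j \<bullet> u) \<noteq> 0"
    by (rule contrapos_pn) (simp only: zero_power2 mult_zero_left less_irrefl not_False_eq_True)
  then have adm: "\<forall>j\<in>?J. v j \<bullet> u \<noteq> 0"
    by auto
  have "log_gradient v ?J u = real n *\<^sub>R u"
    using log_gradient_at_maximum[of u ?J v] u adm max by simp
  then have attained: "(\<Sum>j=1..n. 1 / (v j \<bullet> u)\<^sup>2) = (real n)\<^sup>2"
    unfolding norm_eq[OF adm] using u by simp
  show ?thesis
  proof (rule cInf_eq_minimum)
    show "(real n)\<^sup>2 \<in> {(\<Sum>j=1..n. 1 / (v j \<bullet> u)\<^sup>2) | u.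
        u \<in> sphere 0 1 \<and> (\<forall>j\<in>?J. v j \<bullet> u \<noteq> 0)}"
      using attained u adm by force
  qed (use lower in blast)
qed

end
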